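(* Let $m\ge 2$, $k\ge 0$, $n=m+k$, and let $\boldsymbol a:=(i,\dots,i,r_{m+1},\dots,r_{m+k})\in\mathbb{C}^m\times\mathbb{R}^k$ (the first $m$ coordinates are equal to the imaginary unit $i$). Then the maximal ideal $S_{\boldsymbol a}$ of $\mathbb{R}[x_1,\dots,x_n]$ is generated by the following $2^m-2$ multilinear polynomials: - $x_1-x_j$ for $1<j\le m$; - for every $\ell$ with $2\le \ell\le m$ and all indices $1\le j_1<\dots<j_\ell\le m$, the polynomial $$\begin{cases} x_1-\prod_{s=1}^{\ell}x_{j_s} & \text{if } \ell\equiv 1 \bmod 4,\\ 1+\prod_{s=1}^{\ell}x_{j_s} & \text{if } \ell\equiv 2 \bmod 4,\\ x_1+\prod_{s=1}^{\ell}x_{j_s} & \text{if } \ell\equiv 3 \bmod 4,\\ 1-\prod_{s=1}^{\ell}x_{j_s} & \text{if } \ell\equiv 0 \bmod 4,\end{cases}$$ together with the polynomials $p_{m+j}:=x_{m+j}-r_{m+j}$, $j=1,\dots,k$.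
   Context: For $\boldsymbol a\in\mathbb{C}^n$, $S_{\boldsymbol a}$ denotes the set of all polynomials $p\in\mathbb{R}[x_1,\dots,x_n]$ that vanish at $\boldsymbol a$ and at $\overline{\boldsymbol a}$ when regarded as polynomials on $\mathbb{C}^n$; here $\overline{\boldsymbol a}$ is the coordinatewise complex conjugate. *)

theory Defs
  imports Complex_Main "HOL-Library.Poly_Mapping" "HOL-Algebra.Ideal"
begin

text \<open>
  Real polynomials in variables indexed by the natural numbers: a monomial is a finitely
  supported exponent function, a polynomial a finitely supported coefficient function on
  monomials, and the multiplication of \<open>poly_mapping\<close> is the convolution product.
\<close>

type_synonym rmpoly = "(nat \<Rightarrow>\<^sub>0 nat) \<Rightarrow>\<^sub>0 real"

definition Var :: "nat \<Rightarrow> rmpoly" where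
  "Var j = Poly_Mapping.single (Poly_Mapping.single j 1) 1"

definition Const :: "real \<Rightarrow> rmpoly" where
  "Const c = Poly_Mapping.single 0 c"

definition vars :: "rmpoly \<Rightarrow> nat set" where
  "vars p = (\<Union>t\<in>Poly_Mapping.keys p. Poly_Mapping.keys t)"

text \<open>The ring \<open>\<real>[x\<^sub>1, \<dots>, x\<^sub>n]\<close>; variables are numbered from 1.\<close>

definition mpoly_ring :: "nat \<Rightarrow> rmpoly ring" where
  "mpoly_ring n =
     \<lparr>carrier = {p. vars p \<subseteq> {1..n}}, mult = (*), one = 1, zero = 0, add = (+)\<rparr>"

definition eval_complex :: "rmpoly \<Rightarrow> (nat \<Rightarrow> complex) \<Rightarrow> complex" where
  "eval_complex p a =
     (\<Sum>t\<in>Poly_Mapping.keys p. of_real (Poly_Mapping.lookup p t) *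
        (\<Prod>i\<in>Poly_Mapping.keys t. a i ^ Poly_Mapping.lookup t i))"

text \<open>
  The set \<open>S\<^sub>a\<close>.  A point of \<open>\<complex>\<^sup>n\<close> is a function on the naturals of which only the values on
  \<open>{1..n}\<close> matter, since the polynomials involve no other variables.
\<close>

definition vanishing_set :: "nat \<Rightarrow> (nat \<Rightarrow> complex) \<Rightarrow> rmpoly set" where
  "vanishing_set n a =
     {p \<in> carrier (mpoly_ring n). eval_complex p a = 0 \<and> eval_complex p (\<lambda>i. cnj (a i)) = 0}"

text \<open>The point \<open>(\<i>, \<dots>, \<i>, r\<^sub>m\<^sub>+\<^sub>1, \<dots>, r\<^sub>m\<^sub>+\<^sub>k)\<close>.\<close>

definition special_point :: "nat \<Rightarrow> (nat \<Rightarrow> real) \<Rightarrow> nat \<Rightarrow> complex" where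
  "special_point m r j = (if j \<le> m then \<i> else of_real (r j))"

text \<open>The index set \<open>J\<close> stands for the increasing tuple \<open>j\<^sub>1 < \<dots> < j\<^sub>l\<close> of its elements.\<close>

definition product_generator :: "nat set \<Rightarrow> rmpoly" where
  "product_generator J =
     (if card J mod 4 = 1 then Var 1 - (\<Prod>j\<in>J. Var j)
      else if card J mod 4 = 2 then 1 + (\<Prod>j\<in>J. Var j)
      else if card J mod 4 = 3 then Var 1 + (\<Prod>j\<in>J. Var j)
      else 1 - (\<Prod>j\<in>J. Var j))"

definition multilinear_generators :: "nat \<Rightarrow> rmpoly set" where
  "multilinear_generators m =
     {Var 1 - Var j | j. 1 < j \<and> j \<le> m} \<union>
     {product_generator J | J. J \<subseteq> {1..m} \<and> 2 \<le> card J}"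

definition real_coordinate_generators :: "nat \<Rightarrow> nat \<Rightarrow> (nat \<Rightarrow> real) \<Rightarrow> rmpoly set" where
  "real_coordinate_generators m k r = {Var (m + j) - Const (r (m + j)) | j. 1 \<le> j \<and> j \<le> k}"

text \<open>Multilinear means of degree at most one in each variable separately; the polynomial need
  not be homogeneous.\<close>

definition multilinear :: "rmpoly \<Rightarrow> bool" where
  "multilinear p \<longleftrightarrow> (\<forall>t\<in>Poly_Mapping.keys p. \<forall>i. Poly_Mapping.lookup t i \<le> 1)"

lemma vars_add: "vars (p + q) \<subseteq> vars p \<union> vars q"
  using Poly_Mapping.keys_add[of p q] by (fastforce simp: vars_def)

lemma vars_uminus: "vars (- p) = vars p"
  by (simp add: vars_def)

lemma vars_mult: "vars (p * q) \<subseteq> vars p \<union> vars q"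
proof
  fix i assume "i \<in> vars (p * q)"
  then obtain t where t: "t \<in> Poly_Mapping.keys (p * q)" and i: "i \<in> Poly_Mapping.keys t"
    by (auto simp: vars_def)
  obtain u v where "t = u + v" "u \<in> Poly_Mapping.keys p" "v \<in> Poly_Mapping.keys q"
    using t Poly_Mapping.keys_mult[of p q] by blast
  with i show "i \<in> vars p \<union> vars q"
    using Poly_Mapping.keys_add[of u v] by (fastforce simp: vars_def)
qed

lemma cring_mpoly_ring: "cring (mpoly_ring n)"
proof (rule cringI)
  show "abelian_group (mpoly_ring n)"
  proof (rule abelian_groupI)
    fix x assume x: "x \<in> carrier (mpoly_ring n)"
    show "\<exists>y\<in>carrier (mpoly_ring n). y \<oplus>\<^bsub>mpoly_ring n\<^esub> x = \<zero>\<^bsub>mpoly_ring n\<^esub>"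
      using x by (intro bexI[of _ "- x"]) (auto simp: mpoly_ring_def vars_uminus)
  qed (use vars_add in \<open>fastforce simp: mpoly_ring_def vars_def add_ac\<close>)+
  show "comm_monoid (mpoly_ring n)"
    by (rule comm_monoidI) (use vars_mult in \<open>fastforce simp: mpoly_ring_def vars_def mult_ac\<close>)+
qed (auto simp: mpoly_ring_def algebra_simps)

end

theory Submission
  imports Defs
begin

text \<open>
  Evaluation at \<open>a\<close> is a real algebra homomorphism with kernel \<open>S\<^sub>a\<close> (real coefficients make the
  condition at the conjugate point redundant), and it maps onto the field \<open>\<complex>\<close>, so \<open>S\<^sub>a\<close> is maximal.
  Modulo the linear generators and \<open>1 + x\<^sub>1x\<^sub>2\<close>, hence modulo \<open>1 + x\<^sub>1\<^sup>2\<close>, every polynomial is congruent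
  to the linear normal form \<open>\<alpha> + \<beta>x\<^sub>1\<close> with \<open>\<alpha> + \<beta>\<i>\<close> its value at \<open>a\<close>; for elements of
  \<open>S\<^sub>a\<close> this normal form is \<open>0\<close>. The coefficient at the square-free monomial of \<open>J\<close> separates the
  product generator of \<open>J\<close> from all others, which gives the count.
\<close>

section \<open>Evaluation\<close>

lemma rmpoly_eq_sum_single:
  "(p :: rmpoly) = (\<Sum>t\<in>Poly_Mapping.keys p. Poly_Mapping.single t (Poly_Mapping.lookup p t))"
  by (rule poly_mapping_eqI)
     (auto simp: lookup_sum lookup_single when_def in_keys_iff if_distrib cong: if_cong)

text \<open>A polynomial is the finite sum of its terms, so a property stable under addition need
  only be checked on single terms.\<close>

lemma rmpoly_additive_induct [case_names zero single add]:
  fixes p :: rmpoly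
  assumes "P 0" "\<And>t c. P (Poly_Mapping.single t c)" "\<And>p q. P p \<Longrightarrow> P q \<Longrightarrow> P (p + q)"
  shows "P p"
proof -
  have "P (\<Sum>t\<in>A. Poly_Mapping.single t (f t))" for A f
    by (induction A rule: infinite_finite_induct) (auto intro: assms)
  then show ?thesis by (subst rmpoly_eq_sum_single)
qed

text \<open>The inner product of \<open>eval_complex\<close>, isolated so that multiplicativity can
  first be settled on monomials.\<close>

definition eval_monom :: "(nat \<Rightarrow>\<^sub>0 nat) \<Rightarrow> (nat \<Rightarrow> complex) \<Rightarrow> complex" where
  "eval_monom t a = (\<Prod>i\<in>Poly_Mapping.keys t. a i ^ Poly_Mapping.lookup t i)"

text \<open>Indices outside the support contribute factors with exponent 0. This lets several
  monomials be evaluated over one common index set.\<close>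

lemma eval_monom_superset:
  assumes "finite A" "Poly_Mapping.keys t \<subseteq> A"
  shows "eval_monom t a = (\<Prod>i\<in>A. a i ^ Poly_Mapping.lookup t i)"
  unfolding eval_monom_def using assms
  by (intro prod.mono_neutral_left) (auto simp: in_keys_iff)

lemma eval_monom_add: "eval_monom (s + t) a = eval_monom s a * eval_monom t a"
proof -
  let ?A = "Poly_Mapping.keys s \<union> Poly_Mapping.keys t"
  have "Poly_Mapping.keys (s + t) \<subseteq> ?A" by (rule Poly_Mapping.keys_add)
  then show ?thesis
    by (simp add: eval_monom_superset[of ?A] lookup_add power_add prod.distrib)
qed

lemma eval_complex_single: "eval_complex (Poly_Mapping.single t c) a = of_real c * eval_monom t a"
  by (simp add: eval_complex_def eval_monom_def)

lemma eval_complex_zero: "eval_complex 0 a = 0"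
  by (simp add: eval_complex_def)

lemma eval_complex_add: "eval_complex (p + q) a = eval_complex p a + eval_complex q a"
  unfolding eval_complex_def
  by (rule setsum_keys_plus_distrib) (simp_all add: algebra_simps)

text \<open>Both sides are additive in each factor, so two nested inductions reduce the claim to a
  pair of single terms, where it is \<open>eval_monom_add\<close>.\<close>

lemma eval_complex_mult: "eval_complex (p * q) a = eval_complex p a * eval_complex q a"
proof (induction p rule: rmpoly_additive_induct)
  case (single s c)
  show ?case
    by (induction q rule: rmpoly_additive_induct)
       (simp_all add: eval_complex_zero eval_complex_add eval_complex_single eval_monom_add
         mult_single distrib_left)
qed (simp_all add: eval_complex_zero eval_complex_add distrib_right)

lemma eval_complex_uminus: "eval_complex (- p) a = - eval_complex p a"
  by (metis add.right_inverse eval_complex_add eval_complex_zero minus_unique)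

lemma eval_complex_diff: "eval_complex (p - q) a = eval_complex p a - eval_complex q a"
  by (metis diff_conv_add_uminus eval_complex_add eval_complex_uminus)

lemma eval_complex_Const: "eval_complex (Const c) a = of_real c"
  by (simp add: Const_def eval_complex_single eval_monom_def)

lemma Const_1: "Const 1 = 1"
  by (simp add: Const_def)

lemma eval_complex_one: "eval_complex 1 a = 1"
  using eval_complex_Const[of 1 a] by (simp add: Const_1)

lemma eval_complex_Var: "eval_complex (Var i) a = a i"
  by (simp add: Var_def eval_complex_single eval_monom_def)

lemma eval_complex_prod: "eval_complex (prod f A) a = (\<Prod>i\<in>A. eval_complex (f i) a)"
  by (induction A rule: infinite_finite_induct) (simp_all add: eval_complex_one eval_complex_mult)

lemmas eval_complex_simps =
  eval_complex_zero eval_complex_one eval_complex_add eval_complex_uminus eval_complex_diff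
  eval_complex_mult eval_complex_Const eval_complex_Var eval_complex_prod

text \<open>Conjugation is a ring homomorphism of the complex numbers and fixes the real
  coefficients.\<close>

lemma eval_complex_cnj: "eval_complex p (\<lambda>i. cnj (a i)) = cnj (eval_complex p a)"
  by (simp add: eval_complex_def)

section \<open>The polynomial ring\<close>

lemma mpoly_ring_simps:
  "monoid.mult (mpoly_ring n) = (*)" "one (mpoly_ring n) = 1"
  "zero (mpoly_ring n) = 0" "ring.add (mpoly_ring n) = (+)"
  by (simp_all add: mpoly_ring_def)

lemma mem_carrier_mpoly_ring: "p \<in> carrier (mpoly_ring n) \<longleftrightarrow> vars p \<subseteq> {1..n}"
  by (simp add: mpoly_ring_def)

lemma mpoly_ring_closed:
  assumes "p \<in> carrier (mpoly_ring n)" "q \<in> carrier (mpoly_ring n)"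
  shows "p + q \<in> carrier (mpoly_ring n)" "p * q \<in> carrier (mpoly_ring n)"
    "p - q \<in> carrier (mpoly_ring n)"
  using assms vars_add[of p q] vars_mult[of p q] vars_add[of p "- q"]
  by (auto simp: mem_carrier_mpoly_ring vars_uminus)

lemma uminus_in_carrier: "p \<in> carrier (mpoly_ring n) \<Longrightarrow> - p \<in> carrier (mpoly_ring n)"
  by (simp add: mem_carrier_mpoly_ring vars_uminus)

lemma Const_in_carrier: "Const c \<in> carrier (mpoly_ring n)"
  by (auto simp: mem_carrier_mpoly_ring vars_def Const_def split: if_splits)

lemma zero_in_carrier: "0 \<in> carrier (mpoly_ring n)"
  by (simp add: mem_carrier_mpoly_ring vars_def)

lemma one_in_carrier: "1 \<in> carrier (mpoly_ring n)"
  by (simp add: mem_carrier_mpoly_ring vars_def)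

lemma Var_in_carrier: "1 \<le> i \<Longrightarrow> i \<le> n \<Longrightarrow> Var i \<in> carrier (mpoly_ring n)"
  by (auto simp: mem_carrier_mpoly_ring vars_def Var_def)

lemma prod_in_carrier:
  "(\<And>i. i \<in> A \<Longrightarrow> f i \<in> carrier (mpoly_ring n)) \<Longrightarrow> prod f A \<in> carrier (mpoly_ring n)"
  by (induction A rule: infinite_finite_induct) (auto intro: one_in_carrier mpoly_ring_closed)

section \<open>Generation of the polynomial ring by constants and variables\<close>

lemma Var_power: "Var i ^ e = Poly_Mapping.single (Poly_Mapping.single i e) 1"
  by (induction e) (simp_all add: Var_def mult_single flip: single_add)

lemma prod_single:
  "(\<Prod>i\<in>A. Poly_Mapping.single (f i) (1 :: real)) = Poly_Mapping.single (sum f A) 1"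
  by (induction A rule: infinite_finite_induct) (simp_all add: mult_single)

lemma monom_eq_sum_single:
  "(t :: nat \<Rightarrow>\<^sub>0 nat) =
    (\<Sum>i\<in>Poly_Mapping.keys t. Poly_Mapping.single i (Poly_Mapping.lookup t i))"
  by (rule poly_mapping_eqI)
     (auto simp: lookup_sum lookup_single when_def in_keys_iff if_distrib cong: if_cong)

lemma single_eq_Const_prod_Var:
  "Poly_Mapping.single t c =
    Const c * (\<Prod>i\<in>Poly_Mapping.keys t. Var i ^ Poly_Mapping.lookup t i)"
  by (simp add: Var_power prod_single Const_def mult_single flip: monom_eq_sum_single)

text \<open>Each term is a constant times a product of powers of variables, so constants and
  \<open>Var 1\<close>, ..., \<open>Var n\<close> generate the ring. The product case carries
  membership in the carrier because absorption into an ideal requires it.\<close>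

lemma mpoly_ring_induct [consumes 1, case_names Const Var add mult]:
  assumes p: "p \<in> carrier (mpoly_ring n)"
    and Const: "\<And>c. P (Const c)"
    and Var: "\<And>i. 1 \<le> i \<Longrightarrow> i \<le> n \<Longrightarrow> P (Var i)"
    and add: "\<And>p q. p \<in> carrier (mpoly_ring n) \<Longrightarrow> q \<in> carrier (mpoly_ring n) \<Longrightarrow>
                P p \<Longrightarrow> P q \<Longrightarrow> P (p + q)"
    and mult: "\<And>p q. p \<in> carrier (mpoly_ring n) \<Longrightarrow> q \<in> carrier (mpoly_ring n) \<Longrightarrow>
                P p \<Longrightarrow> P q \<Longrightarrow> P (p * q)"
  shows "P p"
proof -
  \<comment> \<open>Membership is bundled with \<open>P\<close>, since \<open>add\<close> and
    \<open>mult\<close> require it of every intermediate sum and product.\<close>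
  define Q where "Q q \<longleftrightarrow> q \<in> carrier (mpoly_ring n) \<and> P q" for q
  have Q_Const: "Q (Const c)" for c
    by (simp add: Q_def Const Const_in_carrier)
  have Q_0: "Q 0" and Q_1: "Q 1"
    using Q_Const[of 0] Q_Const[of 1] by (simp_all add: Const_def)
  have Q_mult: "Q q \<Longrightarrow> Q q' \<Longrightarrow> Q (q * q')" and Q_add: "Q q \<Longrightarrow> Q q' \<Longrightarrow> Q (q + q')" for q q'
    by (auto simp: Q_def add mult mpoly_ring_closed)
  have Q_pow: "Q (Var i ^ e)" if "1 \<le> i" "i \<le> n" for i e
  proof -
    have "Q (Var i)" using that by (simp add: Q_def Var Var_in_carrier)
    then show ?thesis by (induction e) (simp_all add: Q_1 Q_mult)
  qed
  have Q_prod: "Q (prod f A)" if "\<And>i. i \<in> A \<Longrightarrow> Q (f i)" for A :: "nat set" and f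
    using that by (induction A rule: infinite_finite_induct) (auto intro: Q_1 Q_mult)
  have Q_sum: "Q (sum f A)" if "\<And>t. t \<in> A \<Longrightarrow> Q (f t)" for A :: "(nat \<Rightarrow>\<^sub>0 nat) set" and f
    using that by (induction A rule: infinite_finite_induct) (auto intro: Q_0 Q_add)
  have "Q (\<Sum>t\<in>Poly_Mapping.keys p. Poly_Mapping.single t (Poly_Mapping.lookup p t))"
  proof (intro Q_sum)
    fix t assume t: "t \<in> Poly_Mapping.keys p"
    have "1 \<le> i \<and> i \<le> n" if "i \<in> Poly_Mapping.keys t" for i
      using p t that by (fastforce simp: mem_carrier_mpoly_ring vars_def)
    then show "Q (Poly_Mapping.single t (Poly_Mapping.lookup p t))"
      unfolding single_eq_Const_prod_Var by (intro Q_mult Q_Const Q_prod Q_pow) auto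
  qed
  then show ?thesis
    by (simp add: Q_def flip: rmpoly_eq_sum_single)
qed

text \<open>Translates the ideal laws from the operations of the ring record to the type class
  operations on polynomials.\<close>

lemma mpoly_ring_ideal_closed:
  assumes "ideal I (mpoly_ring n)"
  shows "0 \<in> I"
    and "p \<in> I \<Longrightarrow> q \<in> I \<Longrightarrow> p + q \<in> I"
    and "p \<in> I \<Longrightarrow> q \<in> carrier (mpoly_ring n) \<Longrightarrow> q * p \<in> I"
    and "p \<in> I \<Longrightarrow> - p \<in> I"
    and "p \<in> I \<Longrightarrow> q \<in> I \<Longrightarrow> p - q \<in> I"
proof -
  interpret ideal I "mpoly_ring n" by fact
  show "0 \<in> I"
    using additive_subgroup.zero_closed[OF additive_subgroup_axioms]
    by (simp add: mpoly_ring_simps)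
  show add: "p + q \<in> I" if "p \<in> I" "q \<in> I" for p q
    using additive_subgroup.a_closed[OF additive_subgroup_axioms that] by (simp add: mpoly_ring_simps)
  show mult: "q * p \<in> I" if "p \<in> I" "q \<in> carrier (mpoly_ring n)" for p q
    using I_l_closed[OF that] by (simp add: mpoly_ring_simps)
  show uminus: "- p \<in> I" if "p \<in> I" for p
    using mult[OF that uminus_in_carrier[OF one_in_carrier]] by simp
  show "p - q \<in> I" if "p \<in> I" "q \<in> I"
    using add[OF that(1) uminus[OF that(2)]] by simp
qed

section \<open>The vanishing ideal\<close>

lemma vanishing_set_eq:
  "vanishing_set n a = {p \<in> carrier (mpoly_ring n). eval_complex p a = 0}"
  by (auto simp: vanishing_set_def eval_complex_cnj)

lemma ideal_vanishing_set: "ideal (vanishing_set n a) (mpoly_ring n)"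
proof (rule idealI)
  interpret R: cring "mpoly_ring n" by (rule cring_mpoly_ring)
  show "Ring.ring (mpoly_ring n)" by (rule R.ring_axioms)
  show "subgroup (vanishing_set n a) (add_monoid (mpoly_ring n))"
  proof (rule R.add.subgroupI)
    fix p assume p: "p \<in> vanishing_set n a"
    then have "- p \<in> carrier (mpoly_ring n)" "p \<in> carrier (mpoly_ring n)"
      by (auto simp: vanishing_set_eq uminus_in_carrier)
    \<comment> \<open>Negation in the ring structure is defined abstractly; uniqueness of additive
      inverses identifies it with \<open>- p\<close>.\<close>
    then have "\<ominus>\<^bsub>mpoly_ring n\<^esub> p = - p"
      by (intro R.minus_equality) (simp_all add: mpoly_ring_simps)
    with p show "\<ominus>\<^bsub>mpoly_ring n\<^esub> p \<in> vanishing_set n a"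
      by (simp add: vanishing_set_eq uminus_in_carrier eval_complex_simps)
  next
    show "vanishing_set n a \<noteq> {}"
      using zero_in_carrier[of n] by (auto simp: vanishing_set_eq eval_complex_simps)
  qed (auto simp: vanishing_set_eq mpoly_ring_simps eval_complex_simps intro: mpoly_ring_closed)
qed (auto simp: vanishing_set_eq mpoly_ring_simps eval_complex_simps intro: mpoly_ring_closed)

text \<open>A real polynomial representative of a complex number, with \<open>Var 1\<close> in the
  role of the imaginary unit: a right inverse of evaluation at any point whose first coordinate is
  \<open>\<i>\<close>.\<close>

definition linear_form :: "complex \<Rightarrow> rmpoly" where
  "linear_form z = Const (Re z) + Const (Im z) * Var 1"

lemma linear_form_in_carrier: "1 \<le> n \<Longrightarrow> linear_form z \<in> carrier (mpoly_ring n)"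
  unfolding linear_form_def by (intro mpoly_ring_closed Const_in_carrier Var_in_carrier) auto

lemma eval_linear_form: "a 1 = \<i> \<Longrightarrow> eval_complex (linear_form z) a = z"
  by (simp add: linear_form_def eval_complex_simps complex_eq_iff)

lemma Const_add: "Const (c + d) = Const c + Const d"
  by (simp add: Const_def single_add)

lemma Const_mult: "Const (c * d) = Const c * Const d"
  by (simp add: Const_def mult_single)

lemma Const_diff: "Const (c - d) = Const c - Const d"
  by (simp add: Const_def single_diff)

lemma Const_0: "Const 0 = 0"
  by (simp add: Const_def)

lemma linear_form_add: "linear_form (z + w) = linear_form z + linear_form w"
  by (simp add: linear_form_def Const_add algebra_simps)

text \<open>Multiplying out leaves a single quadratic term in \<open>Var 1\<close>, which complex
  multiplication replaces by its negated coefficient. The defect is thus a multiple of the minimal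
  polynomial of \<open>\<i>\<close>.\<close>

lemma linear_form_mult:
  "linear_form z * linear_form w - linear_form (z * w) =
    Const (Im z * Im w) * (1 + Var 1 * Var 1)"
  by (simp add: linear_form_def Const_add Const_diff Const_mult algebra_simps)

text \<open>Let a larger ideal contain \<open>p\<close> with nonzero value at \<open>a\<close>. The
  linear form \<open>q\<close> of the inverse value makes \<open>q * p - 1\<close> vanish at
  \<open>a\<close>, so this difference lies in the ideal along with \<open>q * p\<close>, and hence
  so does 1.\<close>

lemma maximalideal_vanishing_set:
  assumes "1 \<le> n" "a 1 = \<i>"
  shows "maximalideal (vanishing_set n a) (mpoly_ring n)"
proof (rule maximalidealI)
  show "ideal (vanishing_set n a) (mpoly_ring n)"
    by (rule ideal_vanishing_set)
  show "carrier (mpoly_ring n) \<noteq> vanishing_set n a"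
  proof
    assume "carrier (mpoly_ring n) = vanishing_set n a"
    then have "1 \<in> vanishing_set n a" using one_in_carrier by blast
    then show False by (simp add: vanishing_set_eq eval_complex_one)
  qed
  fix J assume J: "ideal J (mpoly_ring n)" "vanishing_set n a \<subseteq> J" "J \<subseteq> carrier (mpoly_ring n)"
  show "J = vanishing_set n a \<or> J = carrier (mpoly_ring n)"
  proof (rule disjCI)
    assume "J \<noteq> carrier (mpoly_ring n)"
    show "J = vanishing_set n a"
    proof (rule ccontr)
      assume "J \<noteq> vanishing_set n a"
      then obtain p where p: "p \<in> J" "p \<in> carrier (mpoly_ring n)" "eval_complex p a \<noteq> 0"
        using J by (auto simp: vanishing_set_eq)
      define q where "q = linear_form (1 / eval_complex p a)"
      have q: "q \<in> carrier (mpoly_ring n)"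
        using assms by (simp add: q_def linear_form_in_carrier)
      have "q * p - 1 \<in> vanishing_set n a"
        using p q eval_linear_form[of a "1 / eval_complex p a", OF assms(2)]
        by (simp add: vanishing_set_eq eval_complex_simps mpoly_ring_closed one_in_carrier
            flip: q_def)
      moreover have "q * p \<in> J"
        using mpoly_ring_ideal_closed(3)[OF J(1)] p q by blast
      ultimately have "q * p - (q * p - 1) \<in> J"
        using mpoly_ring_ideal_closed(5)[OF J(1)] J(2) by blast
      then have "1 \<in> J" by simp
      then have "carrier (mpoly_ring n) \<subseteq> J"
        using mpoly_ring_ideal_closed(3)[OF J(1), of 1] by auto
      with J(3) \<open>J \<noteq> carrier (mpoly_ring n)\<close> show False by blast
    qed
  qed
qed

text \<open>The congruence of \<open>p\<close> with the linear form of its value, modulo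
  \<open>I\<close>, holds for constants and variables and survives sums and products. A polynomial
  vanishing at \<open>a\<close> has linear form 0.\<close>

lemma vanishing_set_subset_ideal:
  assumes "1 \<le> n" and a1: "a 1 = \<i>" and I: "ideal I (mpoly_ring n)"
    and sq: "1 + Var 1 * Var 1 \<in> I"
    and Var: "\<And>i. 1 \<le> i \<Longrightarrow> i \<le> n \<Longrightarrow> Var i - linear_form (a i) \<in> I"
  shows "vanishing_set n a \<subseteq> I"
proof
  note I_closed = mpoly_ring_ideal_closed[OF I]
  have red: "p - linear_form (eval_complex p a) \<in> I" if "p \<in> carrier (mpoly_ring n)" for p
    using that
  proof (induction p rule: mpoly_ring_induct)
    case (Const c)
    show ?case
      by (simp add: eval_complex_simps linear_form_def Const_0 I_closed(1))
  next
    case (Var i)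
    then show ?case
      by (simp add: eval_complex_simps assms(5))
  next
    case (add p q)
    then show ?case
      using I_closed(2)[OF add.IH] by (simp add: eval_complex_simps linear_form_add algebra_simps)
  next
    case (mult p q)
    let ?z = "eval_complex p a" and ?w = "eval_complex q a"
    \<comment> \<open>The first two summands telescope to \<open>p * q\<close> minus the product of
      the two linear forms; by \<open>linear_form_mult\<close> the third replaces that product by
      the linear form of \<open>?z * ?w\<close>.\<close>
    have "q * (p - linear_form ?z) + linear_form ?z * (q - linear_form ?w) +
        Const (Im ?z * Im ?w) * (1 + Var 1 * Var 1) \<in> I"
      by (intro I_closed(2) I_closed(3)[OF mult.IH(1)] I_closed(3)[OF mult.IH(2)]
          I_closed(3)[OF sq] linear_form_in_carrier Const_in_carrier mult.hyps assms(1))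
    then show ?case
      unfolding linear_form_mult[symmetric] by (simp add: eval_complex_simps algebra_simps)
  qed
  fix p assume "p \<in> vanishing_set n a"
  then show "p \<in> I"
    using red[of p] by (simp add: vanishing_set_eq linear_form_def Const_0)
qed

section \<open>The generators\<close>

lemma i_power_mod: "\<i> ^ l = \<i> ^ (l mod 4)"
proof -
  have "\<i> ^ l = \<i> ^ (4 * (l div 4) + l mod 4)" by simp
  also have "\<dots> = \<i> ^ (l mod 4)" unfolding power_add power_mult by simp
  finally show ?thesis .
qed

text \<open>The product of the variables in \<open>J\<close> takes the value
  \<open>\<i> ^ card J\<close>, which is \<open>\<i>\<close>, -1, \<open>-\<i>\<close> or 1 for
  residue 1, 2, 3 or 0. The four cases of \<open>product_generator\<close> are chosen to cancel
  these values.\<close>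

lemma eval_product_generator:
  assumes "J \<subseteq> {1..m}" "1 \<le> m"
  shows "eval_complex (product_generator J) (special_point m r) = 0"
proof -
  have "(\<Prod>j\<in>J. special_point m r j) = (\<Prod>j\<in>J. \<i>)"
    using assms by (intro prod.cong) (auto simp: special_point_def)
  also have "\<dots> = \<i> ^ (card J mod 4)" by (simp flip: i_power_mod)
  finally have prod: "(\<Prod>j\<in>J. special_point m r j) = \<i> ^ (card J mod 4)" .
  \<comment> \<open>Stated at \<open>Suc 0\<close> because the simplifier rewrites the index 1 to
    this form.\<close>
  have first: "special_point m r (Suc 0) = \<i>"
    using assms(2) by (simp add: special_point_def)
  have "card J mod 4 = 0 \<or> card J mod 4 = 1 \<or> card J mod 4 = 2 \<or> card J mod 4 = 3" by linarith
  then show ?thesis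
    by (elim disjE)
       (simp_all add: product_generator_def eval_complex_simps prod first
         power2_eq_square power3_eq_cube)
qed

lemma product_generator_in_carrier:
  assumes "J \<subseteq> {1..n}" "1 \<le> n"
  shows "product_generator J \<in> carrier (mpoly_ring n)"
proof -
  have "Var 1 \<in> carrier (mpoly_ring n)" "(\<Prod>j\<in>J. Var j) \<in> carrier (mpoly_ring n)"
    using assms by (auto intro!: Var_in_carrier prod_in_carrier)
  then show ?thesis
    by (auto simp: product_generator_def one_in_carrier intro: mpoly_ring_closed)
qed

lemma generators_subset_vanishing_set:
  assumes "1 \<le> m"
  shows "multilinear_generators m \<union> real_coordinate_generators m k r
           \<subseteq> vanishing_set (m + k) (special_point m r)" (is "?G \<subseteq> ?S")
proof -
  have "Var 1 - Var j \<in> ?S" if "1 < j" "j \<le> m" for j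
    using that by (auto simp: vanishing_set_eq special_point_def eval_complex_simps
        intro!: mpoly_ring_closed Var_in_carrier)
  moreover have "product_generator J \<in> ?S" if "J \<subseteq> {1..m}" for J
    using that assms
    by (auto simp: vanishing_set_eq eval_product_generator intro!: product_generator_in_carrier)
  moreover have "Var (m + j) - Const (r (m + j)) \<in> ?S" if "1 \<le> j" "j \<le> k" for j
    using that by (auto simp: vanishing_set_eq special_point_def eval_complex_simps
        intro!: mpoly_ring_closed Var_in_carrier Const_in_carrier)
  ultimately show ?thesis
    unfolding multilinear_generators_def real_coordinate_generators_def by blast
qed

lemma vanishing_set_eq_genideal:
  assumes m: "2 \<le> m"
  shows "vanishing_set (m + k) (special_point m r) =
    Idl\<^bsub>mpoly_ring (m + k)\<^esub> (multilinear_generators m \<union> real_coordinate_generators m k r)"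
proof -
  let ?R = "mpoly_ring (m + k)" and ?a = "special_point m r"
  define G where "G = multilinear_generators m \<union> real_coordinate_generators m k r"
  interpret R: cring ?R by (rule cring_mpoly_ring)
  have G_sub: "G \<subseteq> vanishing_set (m + k) ?a"
    unfolding G_def using m by (intro generators_subset_vanishing_set) simp
  then have G_carrier: "G \<subseteq> carrier ?R" by (auto simp: vanishing_set_eq)
  have ideal: "ideal (Idl\<^bsub>?R\<^esub> G) ?R" by (rule R.genideal_ideal[OF G_carrier])
  note I_closed = mpoly_ring_ideal_closed[OF ideal]
  have G_Idl: "p \<in> Idl\<^bsub>?R\<^esub> G" if "p \<in> G" for p
    using R.genideal_self[OF G_carrier] that by blast
  have lin: "Var 1 - Var j \<in> Idl\<^bsub>?R\<^esub> G" if "1 < j" "j \<le> m" for j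
    using that by (intro G_Idl) (auto simp: G_def multilinear_generators_def)
  \<comment> \<open>Since \<open>m\<close> is at least 2, the pair \<open>{1, 2}\<close> is
    admissible and yields \<open>1 + Var 1 * Var 2\<close>. Adding
    \<open>Var 1 * (Var 1 - Var 2)\<close> turns this into \<open>1 + Var 1 * Var 1\<close>.\<close>
  have "product_generator {1, 2} \<in> G"
    using m by (auto simp: G_def multilinear_generators_def intro!: exI[of _ "{1, 2}"])
  then have "1 + Var 1 * Var 2 \<in> Idl\<^bsub>?R\<^esub> G"
    using G_Idl by (force simp: product_generator_def)
  moreover have "Var 1 * (Var 1 - Var 2) \<in> Idl\<^bsub>?R\<^esub> G"
    using m by (intro I_closed(3) lin Var_in_carrier) auto
  ultimately have "(1 + Var 1 * Var 2) + Var 1 * (Var 1 - Var 2) \<in> Idl\<^bsub>?R\<^esub> G"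
    by (rule I_closed(2))
  then have sq: "1 + Var 1 * Var 1 \<in> Idl\<^bsub>?R\<^esub> G"
    by (simp add: algebra_simps)
  have Var: "Var i - linear_form (?a i) \<in> Idl\<^bsub>?R\<^esub> G" if i: "1 \<le> i" "i \<le> m + k" for i
  proof -
    \<comment> \<open>The difference is 0 in the first case, the negative of a linear generator in
      the second, and a real coordinate generator in the third, where the value has no imaginary
      part.\<close>
    consider "i = 1" | "1 < i" "i \<le> m" | "m < i" using i by linarith
    then show ?thesis
    proof cases
      case 1
      then show ?thesis using m
        by (simp add: special_point_def linear_form_def Const_0 Const_1 I_closed(1))
    next
      case 2
      then show ?thesis using I_closed(4)[OF lin[OF 2]]
        by (simp add: special_point_def linear_form_def Const_0 Const_1)
    next
      case 3
      then have "Var i - Const (r i) \<in> G"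
        using i by (auto simp: G_def real_coordinate_generators_def intro!: exI[of _ "i - m"])
      then show ?thesis using 3 G_Idl
        by (simp add: special_point_def linear_form_def Const_0)
    qed
  qed
  have "vanishing_set (m + k) ?a \<subseteq> Idl\<^bsub>?R\<^esub> G"
    using m by (intro vanishing_set_subset_ideal ideal sq Var) (auto simp: special_point_def)
  moreover have "Idl\<^bsub>?R\<^esub> G \<subseteq> vanishing_set (m + k) ?a"
    by (rule R.genideal_minimal[OF ideal_vanishing_set G_sub])
  ultimately show ?thesis by (simp add: G_def)
qed

section \<open>Square-free monomials and the number of generators\<close>

definition sqfree_monom :: "nat set \<Rightarrow> (nat \<Rightarrow>\<^sub>0 nat)" where
  "sqfree_monom J = (\<Sum>j\<in>J. Poly_Mapping.single j 1)"

lemma lookup_sqfree_monom: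
  "finite J \<Longrightarrow> Poly_Mapping.lookup (sqfree_monom J) i = (if i \<in> J then 1 else 0)"
  by (simp add: sqfree_monom_def lookup_sum lookup_single when_def)

lemma sqfree_monom_eq_iff:
  assumes "finite J" "finite K"
  shows "sqfree_monom J = sqfree_monom K \<longleftrightarrow> J = K"
proof
  assume "sqfree_monom J = sqfree_monom K"
  then have "(i \<in> J) = (i \<in> K)" for i
    by (metis assms lookup_sqfree_monom zero_neq_one)
  then show "J = K" by blast
qed simp

lemma prod_Var: "(\<Prod>j\<in>J. Var j) = Poly_Mapping.single (sqfree_monom J) 1"
  by (simp add: Var_def prod_single sqfree_monom_def)

lemma Var_eq_single_sqfree_monom: "Var j = Poly_Mapping.single (sqfree_monom {j}) 1"
  using prod_Var[of "{j}"] by simp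

lemma one_eq_single_sqfree_monom: "(1 :: rmpoly) = Poly_Mapping.single (sqfree_monom {}) 1"
  using prod_Var[of "{}"] by simp

text \<open>Besides the monomial of \<open>J\<close>, only the monomial of the empty set or of
  \<open>{1}\<close> can occur, and \<open>2 \<le> card K\<close> rules out both. At
  \<open>J = K\<close> the coefficient is 1 or -1.\<close>

lemma lookup_product_generator:
  assumes "finite J" "finite K" "2 \<le> card K"
  shows "Poly_Mapping.lookup (product_generator J) (sqfree_monom K) \<noteq> 0 \<longleftrightarrow> J = K"
proof -
  have "K \<noteq> {}" "K \<noteq> {1}" using assms(3) by auto
  moreover from this have "Poly_Mapping.lookup (Var 1) (sqfree_monom K) = 0"
    using assms(2)
    by (simp add: Var_eq_single_sqfree_monom lookup_single when_def sqfree_monom_eq_iff)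
  ultimately show ?thesis
    using assms(1,2)
    by (simp add: product_generator_def prod_Var
        one_eq_single_sqfree_monom lookup_add lookup_minus lookup_single when_def
        sqfree_monom_eq_iff)
qed

lemma lookup_linear_generator:
  assumes "finite K" "2 \<le> card K"
  shows "Poly_Mapping.lookup (Var 1 - Var j) (sqfree_monom K) = 0"
proof -
  have "K \<noteq> {1}" "K \<noteq> {j}" using assms(2) by auto
  then show ?thesis
    using assms(1)
    by (simp add: Var_eq_single_sqfree_monom lookup_minus lookup_single when_def
        sqfree_monom_eq_iff)
qed

text \<open>The point whose coordinate at each index is that index itself separates the
  variables.\<close>

lemma Var_eq_iff: "Var i = Var j \<longleftrightarrow> i = j"
proof
  assume "Var i = Var j"
  then have "eval_complex (Var i) of_nat = eval_complex (Var j) of_nat" by simp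
  then show "i = j" by (simp add: eval_complex_simps)
qed simp

text \<open>The empty set and the \<open>card A\<close> singletons are removed from the power
  set.\<close>

lemma card_subsets_two_le:
  assumes "finite A"
  shows "card {J. J \<subseteq> A \<and> 2 \<le> card J} = 2 ^ card A - 1 - card A"
proof -
  have "{J. J \<subseteq> A \<and> 2 \<le> card J} = Pow A - insert {} ((\<lambda>x. {x}) ` A)"
  proof (intro Set.set_eqI iffI)
    fix J assume "J \<in> Pow A - insert {} ((\<lambda>x. {x}) ` A)"
    then have J: "J \<subseteq> A" "J \<noteq> {}" "\<And>x. J \<noteq> {x}" by blast+
    then have "card J \<noteq> 0" "card J \<noteq> 1"
      using finite_subset[OF J(1) assms] by (auto simp: card_1_singleton_iff)
    with J show "J \<in> {J. J \<subseteq> A \<and> 2 \<le> card J}" by auto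
  qed auto
  also have "card \<dots> = card (Pow A) - card (insert {} ((\<lambda>x. {x}) ` A))"
    using assms by (intro card_Diff_subset) auto
  also have "card (insert {} ((\<lambda>x. {x}) ` A)) = 1 + card A"
    using assms by (subst card_insert_disjoint) (auto simp: card_image)
  finally show ?thesis using assms by (simp add: card_Pow)
qed

text \<open>There are \<open>m - 1\<close> linear and \<open>2 ^ m - 1 - m\<close> product
  generators. Coefficients at square-free monomials show that no two of the product generators
  coincide and that none is linear.\<close>

lemma card_multilinear_generators:
  assumes "1 \<le> m"
  shows "card (multilinear_generators m) = 2 ^ m - 2"
proof -
  define L where "L = (\<lambda>j. Var 1 - Var j) ` {2..m}"
  define \<J> where "\<J> = {J. J \<subseteq> {1..m} \<and> 2 \<le> card J}"
  have gens: "multilinear_generators m = L \<union> product_generator ` \<J>"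
    by (auto simp: multilinear_generators_def L_def \<J>_def)
  have fin: "finite J" if "J \<in> \<J>" for J
    using that finite_subset by (auto simp: \<J>_def)
  have "finite \<J>" by (simp add: \<J>_def)
  have "inj_on product_generator \<J>"
  proof (rule inj_onI)
    fix J K assume JK: "J \<in> \<J>" "K \<in> \<J>" "product_generator J = product_generator K"
    from fin[OF JK(1)] fin[OF JK(2)] JK(2) have "finite J" "finite K" "2 \<le> card K"
      by (simp_all add: \<J>_def)
    \<comment> \<open>The coefficient at the monomial of \<open>K\<close> is nonzero in the
      generator of \<open>K\<close>, hence in the equal generator of \<open>J\<close>, which forces
      \<open>J = K\<close>.\<close>
    then show "J = K"
      using lookup_product_generator[of K K] lookup_product_generator[of J K] unfolding JK(3)
      by blast
  qed
  then have "card (product_generator ` \<J>) = 2 ^ m - 1 - m"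
    using card_subsets_two_le[of "{1..m}"] by (simp add: card_image \<J>_def)
  moreover have "card L = m - 1"
    by (simp add: L_def card_image inj_on_def Var_eq_iff)
  moreover have "L \<inter> product_generator ` \<J> = {}"
  proof -
    have "product_generator J \<noteq> Var 1 - Var j" if "J \<in> \<J>" for J j
    proof -
      have "finite J" "2 \<le> card J"
        using that fin[OF that] by (simp_all add: \<J>_def)
      then show ?thesis
        using lookup_product_generator[of J J] lookup_linear_generator[of J j] by auto
    qed
    then show ?thesis by (fastforce simp: L_def)
  qed
  ultimately have "card (multilinear_generators m) = (m - 1) + (2 ^ m - 1 - m)"
    using \<open>finite \<J>\<close> by (simp add: gens card_Un_disjoint L_def)
  \<comment> \<open>Makes the truncated subtraction \<open>2 ^ m - 1 - m\<close> exact.\<close>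
  moreover have "m < 2 ^ m" by (rule less_exp)
  ultimately show ?thesis
    using assms by linarith
qed

section \<open>Multilinearity of the generators\<close>

lemma multilinear_single_sqfree_monom:
  assumes "finite J"
  shows "multilinear (Poly_Mapping.single (sqfree_monom J) c)"
  using assms by (simp add: multilinear_def lookup_sqfree_monom)

lemma multilinear_add: "multilinear p \<Longrightarrow> multilinear q \<Longrightarrow> multilinear (p + q)"
  using Poly_Mapping.keys_add[of p q] unfolding multilinear_def by blast

lemma multilinear_diff: "multilinear p \<Longrightarrow> multilinear q \<Longrightarrow> multilinear (p - q)"
  using keys_diff[of p q] unfolding multilinear_def by blast

text \<open>Every generator is a sum or difference of two terms with square-free monomials: 1, a
  variable, or a product of distinct variables.\<close>

lemma multilinear_multilinear_generators:
  assumes "p \<in> multilinear_generators m"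
  shows "multilinear p"
proof -
  have Var: "multilinear (Var j)" and one: "multilinear 1" for j
    by (simp_all only: Var_eq_single_sqfree_monom one_eq_single_sqfree_monom
        multilinear_single_sqfree_monom finite.intros)
  have "multilinear (product_generator J)" if "J \<subseteq> {1..m}" for J
  proof -
    have "multilinear (\<Prod>j\<in>J. Var j)"
      using that unfolding prod_Var
      by (intro multilinear_single_sqfree_monom) (auto intro: finite_subset)
    then show ?thesis
      by (simp add: product_generator_def Var one multilinear_add multilinear_diff)
  qed
  with assms show ?thesis
    by (auto simp: multilinear_generators_def Var multilinear_diff)
qed

theorem theorem1p7:
  fixes m k n :: nat and r :: "nat \<Rightarrow> real" and a :: "nat \<Rightarrow> complex"
  assumes "m \<ge> 2" and "n = m + k" and "a = special_point m r"
  shows "maximalideal (vanishing_set n a) (mpoly_ring n) \<and>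
         vanishing_set n a =
           Idl\<^bsub>mpoly_ring n\<^esub> (multilinear_generators m \<union> real_coordinate_generators m k r) \<and>
         card (multilinear_generators m) = 2 ^ m - 2 \<and>
         (\<forall>p\<in>multilinear_generators m. multilinear p)"
  using assms vanishing_set_eq_genideal[OF assms(1), of k r] card_multilinear_generators[of m]
    maximalideal_vanishing_set[of n a]
  by (auto intro: multilinear_multilinear_generators simp: special_point_def)

end
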